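(* Let $n\ge2$ and let $G$ be the group generated by the transformations $s_0,s_1,s_2$ defined in the context. Then $G$ has order $72$. Furthermore, $G$ is isomorphic to a semidirect product of $W(C_2)$ and $L^\vee/3L^\vee$, namely $W(C_2)\ltimes (L^\vee/3L^\vee)$, where $W(C_2)$ is the Weyl group of the root system $C_2$ and $L^\vee$ is the coroot lattice of $C_2$, with $W(C_2)$ acting naturally.
   Context: Fix $m=(m_1,\dots,m_n)\in\mathbb{N}^n$ and $|M|=m_1+\cdots+m_n$. The transformations act on pairs $(\vec v,x)$ with $\vec v={}^t[a_1,a_2,c,d,e_1,e_2]\in\mathbb{C}^6$, $x=(x_1,\dots,x_n)\in\mathbb{C}^n$: $s_0$ exchanges $a_1$ and $a_2$ and fixes everything else; $s_2$ exchanges $e_1$ and $e_2$ and fixes everything else; $s_1$ sends $(a_1,a_2,c,d,e_1,e_2)$ to $(a_1,\ e_1-a_2,\ e_1-c,\ e_1+e_2-a_2-c,\ e_1,\ e_1+d-a_2-c)$ and $x_i$ to $-m_i+|M|-x_i$ for $1\le i\le n$. The group operation is composition. The coroot of a root $\alpha$ is $\alpha^\vee=2\alpha/(\alpha,\alpha)$, and the coroot lattice $L^\vee$ is the $\mathbb{Z}$-span of all coroots. *)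

theory Defs
  imports
    "HOL-Analysis.Analysis"
    "HOL-Algebra.Bij"
    "HOL-Algebra.Elementary_Groups"
begin

section \<open>The transformations\<close>

text \<open>
  The components \<open>v $ 1, \<dots>, v $ 6\<close> of \<open>v\<close> are \<open>a\<^sub>1, a\<^sub>2, c, d, e\<^sub>1, e\<^sub>2\<close>, in this order
  (in the numeral type \<open>6\<close> the index \<open>6\<close> is the same as \<open>0\<close>).
\<close>

definition s0 :: "(complex ^ 6) \<times> (complex ^ 'n) \<Rightarrow> (complex ^ 6) \<times> (complex ^ 'n)"
  where "s0 = (\<lambda>(v, x). (vector [v $ 2, v $ 1, v $ 3, v $ 4, v $ 5, v $ 6], x))"

definition s1 :: "nat ^ 'n \<Rightarrow>
    (complex ^ 6) \<times> (complex ^ 'n) \<Rightarrow> (complex ^ 6) \<times> (complex ^ 'n)"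
  where "s1 m = (\<lambda>(v, x).
    (vector
      [v $ 1,
       v $ 5 - v $ 2,
       v $ 5 - v $ 3,
       v $ 5 + v $ 6 - v $ 2 - v $ 3,
       v $ 5,
       v $ 5 + v $ 4 - v $ 2 - v $ 3],
     \<chi> i. - of_nat (m $ i) + of_nat (\<Sum>j\<in>UNIV. m $ j) - x $ i))"

definition s2 :: "(complex ^ 6) \<times> (complex ^ 'n) \<Rightarrow> (complex ^ 6) \<times> (complex ^ 'n)"
  where "s2 = (\<lambda>(v, x). (vector [v $ 1, v $ 2, v $ 3, v $ 4, v $ 6, v $ 5], x))"

definition transformation_group ::
    "nat ^ 'n \<Rightarrow> ((complex ^ 6) \<times> (complex ^ 'n) \<Rightarrow> (complex ^ 6) \<times> (complex ^ 'n)) monoid"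
  where "transformation_group m = subgroup_generated (BijGroup UNIV) {s0, s1 m, s2}"

text \<open>
  \<open>subgroup_generated G S\<close> discards the elements of \<open>S\<close> outside \<open>G\<close>; the following facts show
  that none of the three transformations is lost.
\<close>

lemma vector_6:
  fixes a b c d e f :: "'a::zero"
  shows "(vector [a, b, c, d, e, f] :: 'a ^ 6) $ 1 = a"
    "(vector [a, b, c, d, e, f] :: 'a ^ 6) $ 2 = b"
    "(vector [a, b, c, d, e, f] :: 'a ^ 6) $ 3 = c"
    "(vector [a, b, c, d, e, f] :: 'a ^ 6) $ 4 = d"
    "(vector [a, b, c, d, e, f] :: 'a ^ 6) $ 5 = e"
    "(vector [a, b, c, d, e, f] :: 'a ^ 6) $ 6 = f"
  unfolding vector_def by simp_all

lemma exhaust_6: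
  fixes i :: 6
  shows "i = 1 \<or> i = 2 \<or> i = 3 \<or> i = 4 \<or> i = 5 \<or> i = 6"
proof (induct i)
  case (of_int z)
  then have "z = 0 \<or> z = 1 \<or> z = 2 \<or> z = 3 \<or> z = 4 \<or> z = 5"
    by fastforce
  then show ?case by auto
qed

lemma vec6_eq_iff:
  fixes v w :: "'a ^ 6"
  shows "v = w \<longleftrightarrow> v $ 1 = w $ 1 \<and> v $ 2 = w $ 2 \<and> v $ 3 = w $ 3 \<and>
    v $ 4 = w $ 4 \<and> v $ 5 = w $ 5 \<and> v $ 6 = w $ 6"
proof
  assume *: "v $ 1 = w $ 1 \<and> v $ 2 = w $ 2 \<and> v $ 3 = w $ 3 \<and>
    v $ 4 = w $ 4 \<and> v $ 5 = w $ 5 \<and> v $ 6 = w $ 6"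
  have "v $ i = w $ i" for i
    using exhaust_6 [of i] * by (elim disjE) (simp_all only:)
  then show "v = w"
    by (simp only: vec_eq_iff) blast
qed blast

lemma s0_s0: "s0 (s0 p) = p"
  by (cases p) (simp add: s0_def vec6_eq_iff vector_6)

lemma s1_s1: "s1 m (s1 m p) = p"
proof (cases p)
  case (Pair v x)
  then show ?thesis
    by (simp add: s1_def vec6_eq_iff vector_6)
qed

lemma s2_s2: "s2 (s2 p) = p"
  by (cases p) (simp add: s2_def vec6_eq_iff vector_6)

lemma involution_in_BijGroup: "(\<And>p. f (f p) = p) \<Longrightarrow> f \<in> carrier (BijGroup UNIV)"
  by (auto simp: BijGroup_def Bij_def intro!: o_bij [of f f])

lemma transformations_in_BijGroup: "{s0, s1 m, s2} \<subseteq> carrier (BijGroup UNIV)"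
  by (auto intro!: involution_in_BijGroup simp: s0_s0 s1_s1 s2_s2)


section \<open>Weyl group and coroot lattice\<close>

definition coroot :: "'a::euclidean_space \<Rightarrow> 'a"
  where "coroot \<alpha> = (2 / (\<alpha> \<bullet> \<alpha>)) *\<^sub>R \<alpha>"

definition reflection :: "'a::euclidean_space \<Rightarrow> 'a \<Rightarrow> 'a"
  where "reflection \<alpha> v = v - (v \<bullet> coroot \<alpha>) *\<^sub>R \<alpha>"

definition weyl_group :: "'a::euclidean_space set \<Rightarrow> ('a \<Rightarrow> 'a) monoid"
  where "weyl_group \<Phi> = subgroup_generated (BijGroup UNIV) (reflection ` \<Phi>)"

lemma reflection_in_BijGroup: "\<alpha> \<noteq> 0 \<Longrightarrow> reflection \<alpha> \<in> carrier (BijGroup UNIV)"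
  by (rule involution_in_BijGroup) (simp add: reflection_def coroot_def algebra_simps)

definition additive_group :: "'a::ab_group_add monoid"
  where "additive_group = \<lparr>carrier = UNIV, mult = (+), one = 0\<rparr>"

definition coroot_lattice :: "'a::euclidean_space set \<Rightarrow> 'a monoid"
  where "coroot_lattice \<Phi> = subgroup_generated additive_group (coroot ` \<Phi>)"

definition coroot_lattice_mod :: "nat \<Rightarrow> 'a::euclidean_space set \<Rightarrow> 'a set monoid"
  where "coroot_lattice_mod k \<Phi> =
    coroot_lattice \<Phi> Mod ((\<lambda>x. of_nat k *\<^sub>R x) ` carrier (coroot_lattice \<Phi>))"

text \<open>The long roots \<open>\<plusminus>2\<epsilon>\<^sub>i\<close> and the short roots \<open>\<plusminus>\<epsilon>\<^sub>1 \<plusminus> \<epsilon>\<^sub>2\<close>.\<close>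

definition root_system_C2 :: "(real ^ 2) set"
  where "root_system_C2 =
    {vector [2, 0], vector [-2, 0], vector [0, 2], vector [0, -2],
     vector [1, 1], vector [1, -1], vector [-1, 1], vector [-1, -1]}"


section \<open>Semidirect products\<close>

text \<open>
  \<open>H \<ltimes> N\<close> for a left action \<open>\<phi>\<close> of \<open>H\<close> on \<open>N\<close> by automorphisms; the pair \<open>(h, n)\<close> stands for
  the product \<open>n h\<close>, where \<open>h n h\<inverse> = \<phi> h n\<close>.
\<close>

definition semidirect_product ::
    "('a, 'c) monoid_scheme \<Rightarrow> ('b, 'd) monoid_scheme \<Rightarrow> ('a \<Rightarrow> 'b \<Rightarrow> 'b) \<Rightarrow> ('a \<times> 'b) monoid"
  where "semidirect_product H N \<phi> =
    \<lparr>carrier = carrier H \<times> carrier N,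
     mult = (\<lambda>(h, n) (h', n'). (h \<otimes>\<^bsub>H\<^esub> h', n \<otimes>\<^bsub>N\<^esub> \<phi> h n')),
     one = (\<one>\<^bsub>H\<^esub>, \<one>\<^bsub>N\<^esub>)\<rparr>"

end

theory Submission
  imports Defs
begin

text \<open>
  Both groups are the group of affine signed permutations
  \<open>y\<^sub>j \<mapsto> a\<^sub>j y\<^sub>j\<^sub>+\<^sub>s + p\<^sub>j\<close> (\<open>a\<^sub>j = \<plusminus>1\<close>) of the plane over the field with three elements,
  which has \<open>2 \<cdot> 2\<^sup>2 \<cdot> 3\<^sup>2 = 72\<close> elements.

  For the semidirect product this is a matter of coordinates: \<open>W(C\<^sub>2)\<close> consists of the signed
  permutations of the two coordinates of the real plane, the coroot lattice consists of the points
  with integral coordinates, and so \<open>L\<^sup>\<or>/3L\<^sup>\<or>\<close> is the plane over the field with three elements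
  (\<open>semidirect_product_iso\<close>).

  For the transformations the idea is to look at the orbit of the linear form \<open>a\<^sub>1 - d\<close>. It
  consists of the six forms
    \<open>a\<^sub>1 - d, a\<^sub>2 - d, -c\<close> and \<open>a\<^sub>1 + a\<^sub>2 + c - e\<^sub>1 - e\<^sub>2, c - e\<^sub>2, c - e\<^sub>1\<close>,
  which are linearly independent, hence coordinates on the space of all \<open>v\<close>. In these coordinates
  \<open>s\<^sub>0\<close> exchanges the first two forms, \<open>s\<^sub>2\<close> the last two, and \<open>s\<^sub>1\<close> exchanges the two triples in
  the given order. Place the forms on the six lines \<open>y\<^sub>j = t\<close> of the plane over the field
  with three elements, the first triple on \<open>y\<^sub>1 = 0, 1, 2\<close> and the second on \<open>y\<^sub>2 = 0, 1, 2\<close>. Then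
  \<open>s\<^sub>0\<close> comes from the affine reflection \<open>y\<^sub>1 \<mapsto> 1 - y\<^sub>1\<close>, \<open>s\<^sub>1\<close> from the exchange of \<open>y\<^sub>1\<close> and \<open>y\<^sub>2\<close>,
  and \<open>s\<^sub>2\<close> from \<open>y\<^sub>2 \<mapsto> - y\<^sub>2\<close>. These three maps generate all affine signed permutations
  (\<open>signed_affine_generated\<close>), and an affine signed permutation is determined by what it does to
  the six lines (\<open>inj_on_transformation\<close>). The effect on \<open>x\<close> creates no further elements: it is a
  fixed involution that is applied exactly when the two triples are exchanged.
\<close>

section \<open>Residues modulo two and three\<close>

lemma cases_mod3: "(t::3) = 0 \<or> t = 1 \<or> t = 2"
  using exhaust_3[of t] by auto

lemma forall_mod3: "(\<forall>t::3. P t) \<longleftrightarrow> P 0 \<and> P 1 \<and> P 2"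
  using cases_mod3 by metis

lemma nonzero_mod3: "(a::3) \<noteq> 0 \<longleftrightarrow> a = 1 \<or> a = -1"
  using cases_mod3[of a] by auto

lemma unit_mod3_square: "(a::3) \<noteq> 0 \<Longrightarrow> a * a = 1"
  using cases_mod3[of a] by auto

lemma unit_mod3_mult: "(a::3) \<noteq> 0 \<Longrightarrow> b \<noteq> 0 \<Longrightarrow> a * b \<noteq> 0"
  using cases_mod3[of a] cases_mod3[of b] by auto

lemma of_int_mod3_eq_iff: "(of_int i :: 3) = of_int j \<longleftrightarrow> 3 dvd i - j"
proof -
  define r where "r = (i - j) mod 3"
  have r: "r = 0 \<or> r = 1 \<or> r = 2"
    unfolding r_def by presburger
  have "i - j = 3 * ((i - j) div 3) + r"
    by (simp add: r_def)
  then have "(of_int (i - j) :: 3) = of_int (3 * ((i - j) div 3) + r)"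
    by simp
  also have "\<dots> = 3 * of_int ((i - j) div 3) + of_int r"
    by (simp only: of_int_add of_int_mult of_int_numeral)
  also have "(3::3) = 0" by simp
  finally have "(of_int i :: 3) - of_int j = of_int r" by simp
  moreover have "(of_int r :: 3) = 0 \<longleftrightarrow> r = 0"
    using r by auto
  ultimately have "(of_int i :: 3) = of_int j \<longleftrightarrow> r = 0"
    by (metis eq_iff_diff_eq_0)
  then show ?thesis by (simp add: r_def dvd_eq_mod_eq_0)
qed

lemma ex_of_int_mod3: "\<exists>i::int. (of_int i :: 3) = t"
  using cases_mod3[of t] of_int_0 of_int_1 of_int_numeral by metis

lemma cases_mod2: "(s::2) = 0 \<or> s = 1"
  using exhaust_2[of s] by auto

lemma mod2_simps [simp]: "(2::2) + 1 = 1" "(3::2) = 1" "(s::2) + s = 0"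
  using cases_mod2[of s] by auto


section \<open>Affine signed permutations of the plane over the field with three elements\<close>

text \<open>
  The triple \<open>(s, a, p)\<close> stands for the map \<open>y\<^sub>j \<mapsto> a\<^sub>j y\<^sub>j\<^sub>+\<^sub>s + p\<^sub>j\<close>, and the product for the
  composition. Coordinates are numbered modulo two, so that adding \<open>s\<close> to the index covers both
  the identity and the exchange of coordinates; the second coordinate has index \<open>2 = 0\<close>. The signs
  are the nonzero residues modulo three.
\<close>

definition signed_affine :: "(2 \<times> (2 \<Rightarrow> 3) \<times> (2 \<Rightarrow> 3)) monoid"
  where "signed_affine =
    \<lparr>carrier = {(s, a, p). \<forall>j. a j \<noteq> 0},
     mult = (\<lambda>(s, a, p) (s', a', p').
       (s + s', \<lambda>j. a j * a' (j + s), \<lambda>j. p j + a j * p' (j + s))),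
     one = (0, \<lambda>_. 1, \<lambda>_. 0)\<rparr>"

lemma signed_affine_simps:
  "(s, a, p) \<in> carrier signed_affine \<longleftrightarrow> (\<forall>j. a j \<noteq> 0)"
  "(s, a, p) \<otimes>\<^bsub>signed_affine\<^esub> (s', a', p') =
    (s + s', \<lambda>j. a j * a' (j + s), \<lambda>j. p j + a j * p' (j + s))"
  "\<one>\<^bsub>signed_affine\<^esub> = (0, \<lambda>_. 1, \<lambda>_. 0)"
  by (simp_all add: signed_affine_def)

lemma group_signed_affine: "group signed_affine"
proof (rule groupI)
  fix x y assume "x \<in> carrier signed_affine" "y \<in> carrier signed_affine"
  then show "x \<otimes>\<^bsub>signed_affine\<^esub> y \<in> carrier signed_affine"
    by (cases x; cases y) (simp add: signed_affine_simps unit_mod3_mult)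
next
  fix x y z
  show "x \<otimes>\<^bsub>signed_affine\<^esub> y \<otimes>\<^bsub>signed_affine\<^esub> z = x \<otimes>\<^bsub>signed_affine\<^esub> (y \<otimes>\<^bsub>signed_affine\<^esub> z)"
    by (cases x; cases y; cases z) (simp add: signed_affine_simps algebra_simps)
next
  fix x assume x: "x \<in> carrier signed_affine"
  then show "\<one>\<^bsub>signed_affine\<^esub> \<otimes>\<^bsub>signed_affine\<^esub> x = x"
    by (cases x) (simp add: signed_affine_simps)
  obtain s a p where [simp]: "x = (s, a, p)" by (cases x)
  have a: "a j \<noteq> 0" for j using x by (simp add: signed_affine_simps)
  show "\<exists>y\<in>carrier signed_affine. y \<otimes>\<^bsub>signed_affine\<^esub> x = \<one>\<^bsub>signed_affine\<^esub>"
    by (rule bexI[of _ "(- s, \<lambda>j. a (j - s), \<lambda>j. - (a (j - s) * p (j - s)))"])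
      (simp_all add: signed_affine_simps a unit_mod3_square)
qed (simp add: signed_affine_simps)

lemma order_signed_affine: "order signed_affine = 72"
proof -
  have "carrier signed_affine = UNIV \<times> (UNIV \<rightarrow>\<^sub>E {1, -1}) \<times> UNIV"
    by (auto simp: signed_affine_def nonzero_mod3 PiE_iff)
  then show ?thesis
    by (simp add: order_def card_cartesian_product card_PiE card_fun power2_eq_square)
qed

text \<open>
  The product of the affine reflection \<open>y\<^sub>1 \<mapsto> 1 - y\<^sub>1\<close> with the linear reflection \<open>y\<^sub>1 \<mapsto> - y\<^sub>1\<close>,
  a conjugate of the third generator, is the unit translation in the first coordinate. Its
  conjugate by the exchange of coordinates is the unit translation in the second one. The powers
  of both yield all translations, and the linear parts are products of sign changes and the
  exchange.
\<close>

lemma signed_affine_generated: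
  "generate signed_affine
    {(0, \<lambda>j. if j = 1 then -1 else 1, \<lambda>j. if j = 1 then 1 else 0),
     (1, \<lambda>_. 1, \<lambda>_. 0),
     (0, \<lambda>j. if j = 1 then 1 else -1, \<lambda>_. 0)} = carrier signed_affine"
    (is "generate ?K {?k0, ?k1, ?k2} = _")
proof
  interpret group ?K by (rule group_signed_affine)
  have sub: "{?k0, ?k1, ?k2} \<subseteq> carrier ?K"
    by (auto simp: signed_affine_simps)
  then show "generate ?K {?k0, ?k1, ?k2} \<subseteq> carrier ?K"
    using generate_in_carrier by blast
  let ?H = "generate ?K {?k0, ?k1, ?k2}"
  have mult: "x \<in> ?H \<Longrightarrow> y \<in> ?H \<Longrightarrow> x \<otimes>\<^bsub>?K\<^esub> y = z \<Longrightarrow> z \<in> ?H" for x y z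
    using generate.eng by metis
  have k: "?k0 \<in> ?H" "?k1 \<in> ?H" "?k2 \<in> ?H" and one: "(0, \<lambda>_. 1, \<lambda>_. 0) \<in> ?H"
    using generate.one[of ?K] by (auto intro: generate.incl simp: signed_affine_simps(3))
  note eq = signed_affine_simps(2) fun_eq_iff forall_2
  have n1: "(0, \<lambda>j. if j = 1 then -1 else 1, \<lambda>_. 0) \<in> ?H"
    by (rule mult[OF mult[OF k(2) k(3) refl] k(2)]) (simp add: eq)
  have t1: "(0, \<lambda>_. 1, \<lambda>j. if j = 1 then 1 else 0) \<in> ?H"
    by (rule mult[OF k(1) n1]) (simp add: eq)
  have t2: "(0, \<lambda>_. 1, \<lambda>j. if j = 1 then 0 else 1) \<in> ?H"
    by (rule mult[OF mult[OF k(2) t1 refl] k(2)]) (simp add: eq)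
  have T1: "(0, \<lambda>_. 1, \<lambda>j. if j = 1 then q else 0) \<in> ?H" for q
  proof -
    have "(0, \<lambda>_. 1, \<lambda>j. if j = 1 then 2 else 0) \<in> ?H"
      by (rule mult[OF t1 t1]) (simp add: eq)
    then show ?thesis using cases_mod3[of q] t1 one by auto
  qed
  have T2: "(0, \<lambda>_. 1, \<lambda>j. if j = 1 then 0 else q) \<in> ?H" for q
  proof -
    have "(0, \<lambda>_. 1, \<lambda>j. if j = 1 then 0 else 2) \<in> ?H"
      by (rule mult[OF t2 t2]) (simp add: eq)
    then show ?thesis using cases_mod3[of q] t2 one by auto
  qed
  show "carrier ?K \<subseteq> ?H"
  proof
    fix x assume x: "x \<in> carrier ?K"
    obtain s a p where [simp]: "x = (s, a, p)" by (cases x)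
    have a: "a j = 1 \<or> a j = -1" for j
      using x by (simp add: signed_affine_simps nonzero_mod3)
    have A1: "(0, \<lambda>j. if j = 1 then a 1 else 1, \<lambda>_. 0) \<in> ?H"
      using a[of 1] n1 one by (auto cong: if_cong)
    have A2: "(0, \<lambda>j. if j = 1 then 1 else a 2, \<lambda>_. 0) \<in> ?H"
      using a[of 2] k(3) one by (auto cong: if_cong)
    have S: "(s, \<lambda>_. 1, \<lambda>_. 0) \<in> ?H"
      using cases_mod2[of s] k(2) one by auto
    show "x \<in> ?H"
      by (rule mult[OF mult[OF mult[OF T1[of "p 1"] T2[of "p 2"] refl] mult[OF A1 A2 refl] refl] S])
        (simp add: eq)
  qed
qed


section \<open>The transformations as permutations of six linear forms\<close>

lemma BijGroup_UNIV:
  "carrier (BijGroup UNIV) = {f. bij f}"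
  "\<one>\<^bsub>BijGroup UNIV\<^esub> = id"
  "bij f \<Longrightarrow> bij g \<Longrightarrow> f \<otimes>\<^bsub>BijGroup UNIV\<^esub> g = f \<circ> g"
  by (auto simp: BijGroup_def Bij_def compose_def)

text \<open>
  The orbit of \<open>a\<^sub>1 - d\<close>: \<open>s\<^sub>1\<close> takes it to the form with index \<open>(2, 0)\<close>, \<open>s\<^sub>0\<close> to \<open>a\<^sub>2 - d\<close>, from
  which \<open>s\<^sub>1\<close>, \<open>s\<^sub>2\<close>, \<open>s\<^sub>1\<close> successively lead to \<open>c - e\<^sub>2\<close>, \<open>c - e\<^sub>1\<close> and \<open>- c\<close>. The indices
  \<open>(j, t)\<close> name the line \<open>y\<^sub>j = t\<close>.
\<close>

definition six_forms :: "complex ^ 6 \<Rightarrow> 2 \<Rightarrow> 3 \<Rightarrow> complex"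
  where "six_forms v = (\<lambda>j t.
    if j = 1
    then (if t = 0 then v $ 1 - v $ 4 else if t = 1 then v $ 2 - v $ 4 else - v $ 3)
    else (if t = 0 then v $ 1 + v $ 2 + v $ 3 - v $ 5 - v $ 6
          else if t = 1 then v $ 3 - v $ 6 else v $ 3 - v $ 5))"

text \<open>
  Twice \<open>d\<close> is the form with index \<open>(2, 0)\<close> minus the sum of the other five; the remaining
  components are then read off one by one.
\<close>

definition vector_of_forms :: "(2 \<Rightarrow> 3 \<Rightarrow> complex) \<Rightarrow> complex ^ 6"
  where "vector_of_forms f =
    (let d = (f 2 0 - f 1 0 - f 1 1 - f 1 2 - f 2 1 - f 2 2) / 2
     in vector [f 1 0 + d, f 1 1 + d, - f 1 2, d, - f 1 2 - f 2 2, - f 1 2 - f 2 1])"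

lemma vector_of_six_forms: "vector_of_forms (six_forms v) = v"
  by (simp add: vector_of_forms_def six_forms_def Let_def vec6_eq_iff vector_6)

lemma six_forms_of_vector: "six_forms (vector_of_forms f) = f"
  by (simp add: vector_of_forms_def six_forms_def Let_def fun_eq_iff forall_2 forall_mod3 vector_6
      field_simps)

text \<open>
  The preimage of the line \<open>y\<^sub>j = t\<close> under \<open>y\<^sub>j \<mapsto> a\<^sub>j y\<^sub>j\<^sub>+\<^sub>s + p\<^sub>j\<close> is the line
  \<open>y\<^sub>j\<^sub>+\<^sub>s = a\<^sub>j (t - p\<^sub>j)\<close>, because \<open>a\<^sub>j\<close> is its own inverse. Taking preimages makes this a left
  action on the functions on lines.
\<close>

fun permute_forms :: "2 \<times> (2 \<Rightarrow> 3) \<times> (2 \<Rightarrow> 3) \<Rightarrow> (2 \<Rightarrow> 3 \<Rightarrow> complex) \<Rightarrow> 2 \<Rightarrow> 3 \<Rightarrow> complex"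
  where "permute_forms (s, a, p) f = (\<lambda>j t. f (j + s) (a j * (t - p j)))"

definition reflect_if :: "nat ^ 'n \<Rightarrow> 2 \<Rightarrow> complex ^ 'n \<Rightarrow> complex ^ 'n"
  where "reflect_if m s x =
    (if s = 0 then x
     else \<chi> i. - of_nat (m $ i) + of_nat (\<Sum>j\<in>UNIV. m $ j) - x $ i)"

definition transformation ::
    "nat ^ 'n \<Rightarrow> 2 \<times> (2 \<Rightarrow> 3) \<times> (2 \<Rightarrow> 3) \<Rightarrow> (complex ^ 6) \<times> (complex ^ 'n) \<Rightarrow> (complex ^ 6) \<times> (complex ^ 'n)"
  where "transformation m k =
    (\<lambda>(v, x). (vector_of_forms (permute_forms k (six_forms v)), reflect_if m (fst k) x))"

lemma permute_forms_mult:
  assumes "k \<in> carrier signed_affine"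
  shows "permute_forms (k \<otimes>\<^bsub>signed_affine\<^esub> k') f = permute_forms k (permute_forms k' f)"
proof -
  obtain s a p s' a' p' where k: "k = (s, a, p)" "k' = (s', a', p')"
    by (cases k; cases k')
  have "a j * b * (t - (p j + a j * q)) = b * (a j * (t - p j) - q)" for j b t q
  proof -
    have "a j * b * (t - (p j + a j * q)) = b * (a j * (t - p j) - a j * a j * q)"
      by (simp add: algebra_simps)
    then show ?thesis
      using assms by (simp add: k signed_affine_simps unit_mod3_square)
  qed
  then show ?thesis
    by (simp add: k signed_affine_simps fun_eq_iff add.assoc)
qed

lemma reflect_if_add: "reflect_if m (s + s') x = reflect_if m s (reflect_if m s' x)"
  using cases_mod2[of s] cases_mod2[of s'] by (auto simp: reflect_if_def vec_eq_iff)

lemma transformation_mult: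
  assumes "k \<in> carrier signed_affine"
  shows "transformation m (k \<otimes>\<^bsub>signed_affine\<^esub> k') = transformation m k \<circ> transformation m k'"
proof -
  have "fst (k \<otimes>\<^bsub>signed_affine\<^esub> k') = fst k + fst k'"
    by (cases k; cases k') (simp add: signed_affine_simps)
  then show ?thesis
    using assms
    by (auto simp: transformation_def fun_eq_iff permute_forms_mult reflect_if_add six_forms_of_vector)
qed

lemma transformation_one: "transformation m \<one>\<^bsub>signed_affine\<^esub> = id"
  by (auto simp: transformation_def fun_eq_iff signed_affine_simps reflect_if_def vector_of_six_forms)

lemma bij_transformation:
  assumes "k \<in> carrier signed_affine"
  shows "bij (transformation m k)"
proof -
  interpret group signed_affine by (rule group_signed_affine)
  show ?thesis
    using assms transformation_mult[of k m "inv\<^bsub>signed_affine\<^esub> k"]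
      transformation_mult[of "inv\<^bsub>signed_affine\<^esub> k" m k]
    by (intro o_bij[of "transformation m (inv\<^bsub>signed_affine\<^esub> k)"]) (simp_all add: transformation_one)
qed

lemma transformation_hom: "transformation m \<in> hom signed_affine (BijGroup UNIV)"
  by (auto intro!: homI simp: BijGroup_UNIV bij_transformation transformation_mult)

text \<open>
  Every function on the six lines is the family of values of the six forms at some vector. The
  indicator functions of single lines therefore show that equal transformations come from maps
  which permute the lines in the same way; the preimages of the lines \<open>y\<^sub>j = t\<close> determine \<open>s\<close>, the
  choice \<open>t = p\<^sub>j\<close> determines \<open>p\<^sub>j\<close>, and then \<open>t = p\<^sub>j + 1\<close> determines \<open>a\<^sub>j\<close>.
\<close>

lemma inj_on_transformation: "inj_on (transformation m) (carrier signed_affine)"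
proof (rule inj_onI)
  fix k k'
  assume k: "k \<in> carrier signed_affine" "k' \<in> carrier signed_affine"
    and eq: "transformation m k = transformation m k'"
  obtain s a p s' a' p' where [simp]: "k = (s, a, p)" "k' = (s', a', p')"
    by (cases k; cases k')
  have "permute_forms k f = permute_forms k' f" for f
  proof -
    have "vector_of_forms (permute_forms k f) = vector_of_forms (permute_forms k' f)"
      using fun_cong[OF eq, of "(vector_of_forms f, 0)"]
      by (simp add: transformation_def six_forms_of_vector del: permute_forms.simps)
    from arg_cong[OF this, of six_forms] show ?thesis
      by (simp only: six_forms_of_vector)
  qed
  then have f: "f (j + s) (a j * (t - p j)) = f (j + s') (a' j * (t - p' j))"
    for f :: "2 \<Rightarrow> 3 \<Rightarrow> complex" and j t
    by (simp add: fun_eq_iff)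
  have same: "s = s'" "a j * (t - p j) = a' j * (t - p' j)" for j t
    using f[of "\<lambda>i u. if i = j + s \<and> u = a j * (t - p j) then 1 else 0" j t]
    by (auto split: if_splits)
  have u: "a' j * a' j = 1" for j
    using k(2) by (simp add: signed_affine_simps unit_mod3_square)
  have p: "p j = p' j" for j
  proof -
    \<comment> \<open>multiplying by the unit \<open>a' j\<close> once more cancels it\<close>
    have "a' j * (a' j * (p j - p' j)) = 0"
      using same(2)[of j "p j"] by simp
    then show ?thesis
      by (simp add: u flip: mult.assoc)
  qed
  have "a j = a' j" for j
    using same(2)[of j "p j + 1"] by (simp add: p)
  with p same(1) show "k = k'" by auto
qed

lemma transformation_generators:
  "transformation m (0, \<lambda>j. if j = 1 then -1 else 1, \<lambda>j. if j = 1 then 1 else 0) = s0"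
  "transformation m (1, \<lambda>_. 1, \<lambda>_. 0) = s1 m"
  "transformation m (0, \<lambda>j. if j = 1 then 1 else -1, \<lambda>_. 0) = s2"
  by (auto simp: transformation_def s0_def s1_def s2_def fun_eq_iff reflect_if_def
      vector_of_forms_def six_forms_def Let_def vec6_eq_iff vector_6 field_simps)

lemma transformation_group_iso: "transformation m \<in> iso signed_affine (transformation_group m)"
proof -
  interpret group_hom signed_affine "BijGroup UNIV" "transformation m"
    by (simp add: group_hom_def group_hom_axioms_def group_signed_affine group_BijGroup
        transformation_hom)
  let ?S = "{(0, \<lambda>j. if j = 1 then -1 else 1, \<lambda>j. if j = 1 then 1 else 0),
     (1, \<lambda>_. 1, \<lambda>_. 0),
     (0, \<lambda>j. if j = 1 then 1 else -1, \<lambda>_. 0)} :: (2 \<times> (2 \<Rightarrow> 3) \<times> (2 \<Rightarrow> 3)) set"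
  have "?S \<subseteq> carrier signed_affine"
    using signed_affine_generated by (metis generate.incl subsetI)
  then have "transformation m ` carrier signed_affine
      = generate (BijGroup UNIV) (transformation m ` ?S)"
    by (simp only: generate_img signed_affine_generated)
  also have "transformation m ` ?S = {s0, s1 m, s2}"
    by (simp add: transformation_generators)
  also have "generate (BijGroup UNIV) \<dots> = carrier (transformation_group m)"
    unfolding transformation_group_def carrier_subgroup_generated
    by (simp only: Int_absorb1[OF transformations_in_BijGroup])
  finally have "transformation m ` carrier signed_affine = carrier (transformation_group m)" .
  moreover have "x \<otimes>\<^bsub>transformation_group m\<^esub> y = x \<otimes>\<^bsub>BijGroup UNIV\<^esub> y" for x y
    by (simp add: transformation_group_def)
  ultimately show ?thesis
    using transformation_hom[of m] inj_on_transformation[of m]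
    by (auto simp: iso_def hom_def bij_betw_def)
qed


section \<open>The Weyl group of type C2 as signed permutations\<close>

definition unit_sign :: "3 \<Rightarrow> real"
  where "unit_sign a = (if a = 1 then 1 else -1)"

definition signed_perm :: "2 \<Rightarrow> (2 \<Rightarrow> 3) \<Rightarrow> real ^ 2 \<Rightarrow> real ^ 2"
  where "signed_perm s a y = (\<chi> j. unit_sign (a j) * y $ (j + s))"

lemma unit_sign_mult: "a \<noteq> 0 \<Longrightarrow> b \<noteq> 0 \<Longrightarrow> unit_sign (a * b) = unit_sign a * unit_sign b"
  by (auto simp: unit_sign_def nonzero_mod3)

lemma signed_perm_comp:
  assumes "\<forall>j. a j \<noteq> 0" "\<forall>j. a' j \<noteq> 0"
  shows "signed_perm s a \<circ> signed_perm s' a' = signed_perm (s + s') (\<lambda>j. a j * a' (j + s))"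
  using assms by (auto simp: signed_perm_def fun_eq_iff unit_sign_mult add.assoc)

lemma signed_perm_one: "signed_perm 0 (\<lambda>_. 1) = id"
  by (auto simp: signed_perm_def fun_eq_iff unit_sign_def)

lemma signed_perm_inverse:
  assumes "\<forall>j. a j \<noteq> 0"
  shows "signed_perm s a \<circ> signed_perm (- s) (\<lambda>j. a (j - s)) = id"
    and "signed_perm (- s) (\<lambda>j. a (j - s)) \<circ> signed_perm s a = id"
  using assms by (simp_all add: signed_perm_comp unit_mod3_square signed_perm_one)

lemma bij_signed_perm: "\<forall>j. a j \<noteq> 0 \<Longrightarrow> bij (signed_perm s a)"
  using signed_perm_inverse o_bij by metis

lemma signed_perm_inject:
  assumes "\<forall>j. a j \<noteq> 0" "\<forall>j. a' j \<noteq> 0" and eq: "signed_perm s a = signed_perm s' a'"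
  shows "s = s'" "a = a'"
proof -
  have y: "unit_sign (a j) * y $ (j + s) = unit_sign (a' j) * y $ (j + s')" for y :: "real ^ 2" and j
    using fun_cong[OF eq, of y] by (simp add: signed_perm_def vec_eq_iff)
  show s: "s = s'"
    using y[of 0 "axis s 1"] by (auto simp: axis_def unit_sign_def split: if_splits)
  have "a j = a' j" for j
    using y[of j "\<chi> i. 1"] assms(1,2)[THEN spec, of j]
    by (auto simp: unit_sign_def nonzero_mod3 split: if_splits)
  then show "a = a'" by auto
qed

text \<open>
  The long roots give the two sign changes, and the short roots the exchange of the coordinates
  and its negative.
\<close>

lemma reflections_C2:
  "reflection ` root_system_C2 =
    {signed_perm 0 (\<lambda>j. if j = 1 then -1 else 1), signed_perm 0 (\<lambda>j. if j = 1 then 1 else -1),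
     signed_perm 1 (\<lambda>_. 1), signed_perm 1 (\<lambda>_. -1)}"
proof -
  have x0: "x $ 0 = x $ 2" for x :: "real ^ 2"
    by (rule arg_cong[of _ _ "($) x"]) simp
  have "reflection (vector [2, 0]) = signed_perm 0 (\<lambda>j. if j = 1 then -1 else 1)"
    "reflection (vector [-2, 0]) = signed_perm 0 (\<lambda>j. if j = 1 then -1 else 1)"
    "reflection (vector [0, 2]) = signed_perm 0 (\<lambda>j. if j = 1 then 1 else -1)"
    "reflection (vector [0, -2]) = signed_perm 0 (\<lambda>j. if j = 1 then 1 else -1)"
    "reflection (vector [1, 1]) = signed_perm 1 (\<lambda>_. -1)"
    "reflection (vector [1, -1]) = signed_perm 1 (\<lambda>_. 1)"
    "reflection (vector [-1, 1]) = signed_perm 1 (\<lambda>_. 1)"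
    "reflection (vector [-1, -1]) = signed_perm 1 (\<lambda>_. -1)"
    by (simp_all add: fun_eq_iff vec_eq_iff forall_2 reflection_def coroot_def signed_perm_def
        unit_sign_def inner_vec_def UNIV_2 x0)
  then show ?thesis
    unfolding root_system_C2_def by auto
qed

lemma carrier_weyl_group_C2:
  "carrier (weyl_group root_system_C2) = {signed_perm s a |s a. \<forall>j. a j \<noteq> 0}"
proof -
  interpret group "BijGroup (UNIV :: (real ^ 2) set)" by (rule group_BijGroup)
  let ?B = "BijGroup (UNIV :: (real ^ 2) set)"
  let ?R = "reflection ` root_system_C2"
  have R: "?R \<subseteq> carrier ?B"
    by (auto simp: reflections_C2 BijGroup_UNIV intro!: bij_signed_perm split: if_splits)
  have "subgroup {signed_perm s a |s a. \<forall>j. a j \<noteq> 0} ?B"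
  proof (rule subgroupI)
    show "{signed_perm s a |s a. \<forall>j. a j \<noteq> 0} \<subseteq> carrier ?B"
      by (auto simp: BijGroup_UNIV bij_signed_perm)
    show "{signed_perm s a |s a. \<forall>j. a j \<noteq> 0} \<noteq> {}"
      by (auto intro!: exI[of _ "\<lambda>_. 1"])
    fix f assume "f \<in> {signed_perm s a |s a. \<forall>j. a j \<noteq> 0}"
    then obtain s a where f: "f = signed_perm s a" and a: "\<forall>j. a j \<noteq> 0" by auto
    have "inv\<^bsub>?B\<^esub> f = signed_perm (- s) (\<lambda>j. a (j - s))"
      unfolding f using a
      by (intro inv_equality) (simp_all add: BijGroup_UNIV bij_signed_perm signed_perm_inverse)
    with a show "inv\<^bsub>?B\<^esub> f \<in> {signed_perm s a |s a. \<forall>j. a j \<noteq> 0}" by auto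
    fix g assume "g \<in> {signed_perm s a |s a. \<forall>j. a j \<noteq> 0}"
    then obtain s' a' where g: "g = signed_perm s' a'" and a': "\<forall>j. a' j \<noteq> 0" by auto
    have "f \<otimes>\<^bsub>?B\<^esub> g = signed_perm (s + s') (\<lambda>j. a j * a' (j + s))"
      using a a' by (simp add: f g BijGroup_UNIV bij_signed_perm signed_perm_comp)
    with a a' show "f \<otimes>\<^bsub>?B\<^esub> g \<in> {signed_perm s a |s a. \<forall>j. a j \<noteq> 0}"
      using unit_mod3_mult by blast
  qed
  then have "generate ?B ?R \<subseteq> {signed_perm s a |s a. \<forall>j. a j \<noteq> 0}"
    by (intro generate_subgroup_incl) (auto 4 4 simp: reflections_C2 split: if_splits)
  moreover have "signed_perm s a \<in> generate ?B ?R" if a: "\<forall>j. a j \<noteq> 0" for s a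
  proof -
    have one: "signed_perm 0 (\<lambda>_. 1) \<in> generate ?B ?R"
      using generate.one[of ?B ?R] by (simp add: signed_perm_one BijGroup_UNIV)
    have "\<And>f. f \<in> ?R \<Longrightarrow> f \<in> generate ?B ?R"
      by (rule generate.incl)
    then have gens: "signed_perm 0 (\<lambda>j. if j = 1 then -1 else 1) \<in> generate ?B ?R"
      "signed_perm 0 (\<lambda>j. if j = 1 then 1 else -1) \<in> generate ?B ?R"
      "signed_perm 1 (\<lambda>_. 1) \<in> generate ?B ?R"
      by (simp_all add: reflections_C2)
    have "signed_perm 0 (\<lambda>j. if j = 1 then a 1 else 1) \<in> generate ?B ?R"
      using a gens one by (cases "a 1 = 1") (auto simp: nonzero_mod3 cong: if_cong)
    moreover have "signed_perm 0 (\<lambda>j. if j = 1 then 1 else a 2) \<in> generate ?B ?R"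
      using a gens one by (cases "a 2 = 1") (auto simp: nonzero_mod3 cong: if_cong)
    moreover have "signed_perm s (\<lambda>_. 1) \<in> generate ?B ?R"
      using cases_mod2[of s] gens one by auto
    ultimately have "signed_perm 0 (\<lambda>j. if j = 1 then a 1 else 1) \<otimes>\<^bsub>?B\<^esub>
        signed_perm 0 (\<lambda>j. if j = 1 then 1 else a 2) \<otimes>\<^bsub>?B\<^esub> signed_perm s (\<lambda>_. 1) \<in> generate ?B ?R"
      by (intro generate.eng)
    also have "signed_perm 0 (\<lambda>j. if j = 1 then a 1 else 1) \<otimes>\<^bsub>?B\<^esub>
        signed_perm 0 (\<lambda>j. if j = 1 then 1 else a 2) \<otimes>\<^bsub>?B\<^esub> signed_perm s (\<lambda>_. 1) =
        signed_perm 0 (\<lambda>j. if j = 1 then a 1 else 1) \<circ>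
        signed_perm 0 (\<lambda>j. if j = 1 then 1 else a 2) \<circ> signed_perm s (\<lambda>_. 1)"
      using a by (simp add: BijGroup_UNIV bij_signed_perm bij_comp)
    also have "\<dots> = signed_perm s a"
    proof -
      have "(\<lambda>j. (if j = 1 then a 1 else 1) * (if j = 1 then 1 else a 2)) = a"
        by (simp add: fun_eq_iff forall_2)
      then show ?thesis
        using a by (simp add: signed_perm_comp)
    qed
    finally show ?thesis .
  qed
  ultimately have "generate ?B ?R = {signed_perm s a |s a. \<forall>j. a j \<noteq> 0}" by auto
  then show ?thesis
    using R by (simp add: weyl_group_def carrier_subgroup_generated Int_absorb1)
qed


section \<open>The coroot lattice modulo three\<close>

lemma group_additive_group: "group (additive_group :: 'a::ab_group_add monoid)"
  by (rule groupI) (auto simp: additive_group_def add.assoc intro: exI[of _ "- _"])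

lemma additive_group_simps:
  "carrier (additive_group :: 'a::ab_group_add monoid) = UNIV"
  "x \<otimes>\<^bsub>additive_group\<^esub> y = (x + y :: 'a)"
  "\<one>\<^bsub>additive_group\<^esub> = (0::'a)"
  by (simp_all add: additive_group_def)

lemma inv_additive_group: "inv\<^bsub>additive_group\<^esub> x = - (x::'a::ab_group_add)"
  by (rule group.inv_equality[OF group_additive_group]) (simp_all add: additive_group_simps)

lemma generate_additive_scaleR:
  fixes x :: "'a::real_vector"
  assumes "x \<in> generate additive_group S"
  shows "of_int i *\<^sub>R x \<in> generate additive_group S"
proof -
  interpret group "additive_group :: 'a monoid" by (rule group_additive_group)
  have neg: "- y \<in> generate additive_group S" if "y \<in> generate additive_group S" for y :: 'a
    using generate_m_inv_closed[OF _ that] by (simp add: additive_group_simps inv_additive_group)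
  have nat: "of_nat n *\<^sub>R x \<in> generate additive_group S" for n
  proof (induction n)
    case 0
    show ?case using generate.one[of additive_group S] by (simp add: additive_group_simps)
  next
    case (Suc n)
    show ?case
      using generate.eng[OF assms Suc] by (simp add: additive_group_simps algebra_simps)
  qed
  show ?thesis
    by (cases i rule: int_cases2) (use nat neg[OF nat] in simp_all)
qed

lemma coroots_C2:
  "coroot ` root_system_C2 =
    {vector [1, 0], vector [-1, 0], vector [0, 1], vector [0, -1],
     vector [1, 1], vector [1, -1], vector [-1, 1], vector [-1, -1]}"
proof -
  have "coroot (vector [2, 0] :: real ^ 2) = vector [1, 0]"
    "coroot (vector [-2, 0] :: real ^ 2) = vector [-1, 0]"
    "coroot (vector [0, 2] :: real ^ 2) = vector [0, 1]"
    "coroot (vector [0, -2] :: real ^ 2) = vector [0, -1]"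
    "coroot (vector [1, 1] :: real ^ 2) = vector [1, 1]"
    "coroot (vector [1, -1] :: real ^ 2) = vector [1, -1]"
    "coroot (vector [-1, 1] :: real ^ 2) = vector [-1, 1]"
    "coroot (vector [-1, -1] :: real ^ 2) = vector [-1, -1]"
    by (simp_all add: vec_eq_iff forall_2 coroot_def inner_vec_def UNIV_2)
  then show ?thesis
    unfolding root_system_C2_def by (simp only: image_insert image_empty)
qed

text \<open>
  The coroots are integral, and those of the long roots include the standard basis vectors.
\<close>

lemma carrier_coroot_lattice_C2:
  "carrier (coroot_lattice root_system_C2) = {y. \<forall>j. y $ j \<in> \<int>}"
proof -
  interpret group "additive_group :: (real ^ 2) monoid" by (rule group_additive_group)
  let ?A = "additive_group :: (real ^ 2) monoid"
  let ?C = "coroot ` root_system_C2"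
  have "subgroup {y. \<forall>j. y $ j \<in> \<int>} ?A"
    by (rule subgroupI) (auto simp: additive_group_simps inv_additive_group intro: exI[of _ 0])
  then have "generate ?A ?C \<subseteq> {y. \<forall>j. y $ j \<in> \<int>}"
    by (intro generate_subgroup_incl) (auto simp: coroots_C2 forall_2)
  moreover have "y \<in> generate ?A ?C" if y: "\<forall>j. y $ j \<in> \<int>" for y
  proof -
    from y obtain i1 i2 where i: "y $ 1 = of_int i1" "y $ 2 = of_int i2"
      by (metis Ints_cases)
    have gen: "vector [1, 0] \<in> generate ?A ?C" "vector [0, 1] \<in> generate ?A ?C"
      by (auto intro!: generate.incl simp: coroots_C2)
    have "of_int i1 *\<^sub>R vector [1, 0] + of_int i2 *\<^sub>R vector [0, 1] \<in> generate ?A ?C"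
      using generate.eng[OF generate_additive_scaleR[OF gen(1)] generate_additive_scaleR[OF gen(2)]]
      by (simp add: additive_group_simps)
    also have "of_int i1 *\<^sub>R vector [1, 0] + of_int i2 *\<^sub>R vector [0, 1] = y"
      by (simp add: vec_eq_iff forall_2 i)
    finally show ?thesis .
  qed
  ultimately show ?thesis
    by (auto simp: coroot_lattice_def carrier_subgroup_generated additive_group_simps)
qed

text \<open>
  The integral points of the plane whose coordinates reduce to \<open>p\<close> modulo three; these sets turn
  out to be the cosets of three times the coroot lattice.
\<close>

definition residue_class :: "(2 \<Rightarrow> 3) \<Rightarrow> (real ^ 2) set"
  where "residue_class p = {y. \<forall>j. \<exists>i::int. y $ j = of_int i \<and> of_int i = p j}"

lemma residue_class_nonempty: "\<exists>y. y \<in> residue_class p"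
proof -
  have "\<forall>j. \<exists>i::int. of_int i = p j"
    using ex_of_int_mod3 by blast
  then obtain i :: "2 \<Rightarrow> int" where "\<forall>j. of_int (i j) = p j"
    by (rule choice[THEN exE])
  then have "(\<chi> j. of_int (i j)) \<in> residue_class p"
    by (auto simp: residue_class_def)
  then show ?thesis ..
qed

lemma residue_class_inject: "residue_class p = residue_class q \<Longrightarrow> p = q"
proof
  fix j assume eq: "residue_class p = residue_class q"
  obtain y where "y \<in> residue_class p" using residue_class_nonempty by blast
  with eq have "\<exists>i::int. y $ j = of_int i \<and> of_int i = p j" "\<exists>i::int. y $ j = of_int i \<and> of_int i = q j"
    unfolding residue_class_def by blast+
  then show "p j = q j" by auto
qed

lemma residue_class_add:
  "y \<in> residue_class p \<Longrightarrow> z \<in> residue_class q \<Longrightarrow> y + z \<in> residue_class (\<lambda>j. p j + q j)"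
  unfolding residue_class_def
  by simp (metis of_int_add)

lemma residue_class_minus:
  "y \<in> residue_class p \<Longrightarrow> z \<in> residue_class q \<Longrightarrow> y - z \<in> residue_class (\<lambda>j. p j - q j)"
  unfolding residue_class_def
  by simp (metis of_int_diff)

lemma residue_class_set_mult:
  "residue_class p <#>\<^bsub>coroot_lattice root_system_C2\<^esub> residue_class q = residue_class (\<lambda>j. p j + q j)"
proof -
  have "\<exists>y\<in>residue_class p. \<exists>x\<in>residue_class q. z = y + x"
    if z: "z \<in> residue_class (\<lambda>j. p j + q j)" for z
  proof -
    obtain y where y: "y \<in> residue_class p" using residue_class_nonempty by blast
    from residue_class_minus[OF z y] have "z - y \<in> residue_class q" by simp
    with y show ?thesis by (metis add.commute diff_add_cancel)
  qed
  then show ?thesis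
    by (auto simp: set_mult_def coroot_lattice_def additive_group_simps residue_class_add)
qed

lemma residue_class_zero:
  "residue_class (\<lambda>_. 0) =
    (\<lambda>x. of_nat 3 *\<^sub>R x) ` carrier (coroot_lattice root_system_C2)"
proof
  show "(\<lambda>x. of_nat 3 *\<^sub>R x) ` carrier (coroot_lattice root_system_C2) \<subseteq> residue_class (\<lambda>_. 0)"
  proof
    fix z assume "z \<in> (\<lambda>x. of_nat 3 *\<^sub>R x) ` carrier (coroot_lattice root_system_C2)"
    then obtain x where z: "z = of_nat 3 *\<^sub>R x" and x: "\<forall>j. x $ j \<in> \<int>"
      by (auto simp: carrier_coroot_lattice_C2)
    have "\<exists>i::int. z $ j = of_int i \<and> of_int i = (0::3)" for j
    proof -
      from x obtain i where "x $ j = of_int i" by (metis Ints_cases)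
      then show ?thesis
        using of_int_mod3_eq_iff[of "3 * i" 0] by (intro exI[of _ "3 * i"]) (simp add: z)
    qed
    then show "z \<in> residue_class (\<lambda>_. 0)" by (simp add: residue_class_def)
  qed
  show "residue_class (\<lambda>_. 0) \<subseteq> (\<lambda>x. of_nat 3 *\<^sub>R x) ` carrier (coroot_lattice root_system_C2)"
  proof
    fix z assume z: "z \<in> residue_class (\<lambda>_. 0)"
    have "z $ j / 3 \<in> \<int>" for j
    proof -
      from z obtain i :: int where i: "z $ j = of_int i" "(of_int i :: 3) = 0"
        by (auto simp: residue_class_def)
      then have "3 dvd i" using of_int_mod3_eq_iff[of i 0] by simp
      then show ?thesis using i by auto
    qed
    then have "(1/3) *\<^sub>R z \<in> carrier (coroot_lattice root_system_C2)"
      by (simp add: carrier_coroot_lattice_C2)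
    then show "z \<in> (\<lambda>x. of_nat 3 *\<^sub>R x) ` carrier (coroot_lattice root_system_C2)"
      by (rule rev_image_eqI) simp
  qed
qed

text \<open>
  Three times the lattice is the class of zero, so the coset of \<open>y\<close> is found by adding and
  subtracting \<open>y\<close>.
\<close>

lemma residue_class_coset:
  assumes "y \<in> residue_class p"
  shows "residue_class (\<lambda>_. 0) #>\<^bsub>coroot_lattice root_system_C2\<^esub> y = residue_class p"
proof -
  have "\<exists>x\<in>residue_class (\<lambda>_. 0). z = x + y" if z: "z \<in> residue_class p" for z
    using residue_class_minus[OF z assms] by (intro bexI[of _ "z - y"]) simp_all
  then show ?thesis
    using residue_class_add[OF _ assms, of _ "\<lambda>_. 0"]
    by (auto simp: r_coset_def coroot_lattice_def additive_group_simps)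
qed

lemma integral_iff_residue_class: "(\<forall>j. y $ j \<in> \<int>) \<longleftrightarrow> (\<exists>p. y \<in> residue_class p)"
proof
  assume "\<forall>j. y $ j \<in> \<int>"
  then have "\<forall>j. \<exists>i. y $ j = of_int i" by (metis Ints_cases)
  then obtain i where "\<forall>j. y $ j = of_int (i j)" by (rule choice[THEN exE])
  then have "y \<in> residue_class (\<lambda>j. of_int (i j))" by (auto simp: residue_class_def)
  then show "\<exists>p. y \<in> residue_class p" by blast
next
  assume "\<exists>p. y \<in> residue_class p"
  then have "\<exists>i. y $ j = of_int i" for j
    unfolding residue_class_def by blast
  then show "\<forall>j. y $ j \<in> \<int>" by (metis Ints_of_int)
qed

lemma coroot_lattice_mod_3_C2:
  "carrier (coroot_lattice_mod 3 root_system_C2) = range residue_class"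
  "X \<otimes>\<^bsub>coroot_lattice_mod 3 root_system_C2\<^esub> Y = X <#>\<^bsub>coroot_lattice root_system_C2\<^esub> Y"
proof -
  have "carrier (coroot_lattice_mod 3 root_system_C2) =
      {residue_class (\<lambda>_. 0) #>\<^bsub>coroot_lattice root_system_C2\<^esub> y |y. \<exists>p. y \<in> residue_class p}"
    unfolding coroot_lattice_mod_def carrier_FactGroup residue_class_zero[symmetric]
    by (auto simp: carrier_coroot_lattice_C2 integral_iff_residue_class)
  also have "\<dots> = {residue_class p |p y. y \<in> residue_class p}"
    using residue_class_coset by blast
  also have "\<dots> = range residue_class"
    using residue_class_nonempty by blast
  finally show "carrier (coroot_lattice_mod 3 root_system_C2) = range residue_class" .
qed (simp add: coroot_lattice_mod_def)

text \<open>
  Only the inclusion of the left side in the right side needs a computation; the other one is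
  the same inclusion for the inverse signed permutation.
\<close>

lemma signed_perm_residue_class:
  assumes a: "\<forall>j. a j \<noteq> 0"
  shows "signed_perm s a ` residue_class p = residue_class (\<lambda>j. a j * p (j + s))"
proof -
  have sub: "signed_perm s a y \<in> residue_class (\<lambda>j. a j * p (j + s))"
    if a: "\<forall>j. a j \<noteq> 0" and y: "y \<in> residue_class p" for s a p y
  proof -
    have "\<exists>i::int. signed_perm s a y $ j = of_int i \<and> of_int i = a j * p (j + s)" for j
    proof -
      from y obtain i :: int where i: "y $ (j + s) = of_int i" "of_int i = p (j + s)"
        unfolding residue_class_def by blast
      show ?thesis
        using i a[THEN spec, of j]
        by (cases "a j = 1")
          (auto simp: signed_perm_def unit_sign_def nonzero_mod3 intro: exI[of _ i] exI[of _ "- i"])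
    qed
    then show ?thesis by (simp add: residue_class_def)
  qed
  show ?thesis
  proof
    show "signed_perm s a ` residue_class p \<subseteq> residue_class (\<lambda>j. a j * p (j + s))"
      using sub a by blast
    show "residue_class (\<lambda>j. a j * p (j + s)) \<subseteq> signed_perm s a ` residue_class p"
    proof
      fix z assume z: "z \<in> residue_class (\<lambda>j. a j * p (j + s))"
      let ?y = "signed_perm (- s) (\<lambda>j. a (j - s)) z"
      have "?y \<in> residue_class (\<lambda>j. a (j - s) * (a (j - s) * p j))"
        using sub[OF _ z, of "\<lambda>j. a (j - s)" "- s"] a by simp
      then have "?y \<in> residue_class p"
        using a by (simp add: unit_mod3_square flip: mult.assoc)
      moreover have "z = signed_perm s a ?y"
        using fun_cong[OF signed_perm_inverse(1)[OF a, of s], of z] by simp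
      ultimately show "z \<in> signed_perm s a ` residue_class p" by blast
    qed
  qed
qed


section \<open>Comparison of the two groups\<close>

text \<open>
  The triple \<open>(s, a, p)\<close> splits into its linear part and its translation part. Composing affine
  maps lets the linear part act on the translation part of the second factor, which is the
  multiplication of the semidirect product.
\<close>

lemma semidirect_product_iso:
  "(\<lambda>(s, a, p). (signed_perm s a, residue_class p)) \<in>
    iso signed_affine
      (semidirect_product (weyl_group root_system_C2) (coroot_lattice_mod 3 root_system_C2)
        (\<lambda>w X. w ` X))"
    (is "?h \<in> iso _ ?P")
proof -
  have carrier: "carrier ?P = {signed_perm s a |s a. \<forall>j. a j \<noteq> 0} \<times> range residue_class"
    by (simp add: semidirect_product_def carrier_weyl_group_C2 coroot_lattice_mod_3_C2)
  have "?h \<in> hom signed_affine ?P"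
  proof (rule homI)
    fix x assume "x \<in> carrier signed_affine"
    then show "?h x \<in> carrier ?P"
      by (cases x) (auto simp: carrier signed_affine_simps)
  next
    fix x y assume "x \<in> carrier signed_affine" "y \<in> carrier signed_affine"
    then show "?h (x \<otimes>\<^bsub>signed_affine\<^esub> y) = ?h x \<otimes>\<^bsub>?P\<^esub> ?h y"
      by (cases x; cases y)
        (simp add: semidirect_product_def signed_affine_simps weyl_group_def BijGroup_UNIV
          bij_signed_perm signed_perm_comp coroot_lattice_mod_3_C2 signed_perm_residue_class
          residue_class_set_mult)
  qed
  moreover have "inj_on ?h (carrier signed_affine)"
  proof (rule inj_onI)
    fix x y assume "x \<in> carrier signed_affine" "y \<in> carrier signed_affine" "?h x = ?h y"
    then show "x = y"
      by (cases x; cases y)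
        (auto simp: signed_affine_simps dest: signed_perm_inject residue_class_inject)
  qed
  moreover have "?h ` carrier signed_affine = carrier ?P"
    by (force simp: carrier signed_affine_def)
  ultimately show ?thesis by (simp add: iso_def bij_betw_def)
qed

theorem lemma2p4:
  fixes m :: "nat ^ 'n"
  assumes "CARD('n) \<ge> 2"
  shows "order (transformation_group m) = 72 \<and>
    transformation_group m \<cong>
      semidirect_product (weyl_group root_system_C2) (coroot_lattice_mod 3 root_system_C2)
        (\<lambda>w X. w ` X)"
proof
  have iso: "signed_affine \<cong> transformation_group m"
    using transformation_group_iso by (rule is_isoI)
  then show "order (transformation_group m) = 72"
    using iso_same_card[OF iso] order_signed_affine by (simp add: order_def)
  have "transformation_group m \<cong> signed_affine"
    using iso by (rule group.iso_sym[OF group_signed_affine])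
  also have "signed_affine \<cong> semidirect_product (weyl_group root_system_C2)
      (coroot_lattice_mod 3 root_system_C2) (\<lambda>w X. w ` X)"
    using semidirect_product_iso by (rule is_isoI)
  finally show "transformation_group m \<cong> semidirect_product (weyl_group root_system_C2)
      (coroot_lattice_mod 3 root_system_C2) (\<lambda>w X. w ` X)" .
qed

end
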